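(* Let $(L,\cdot,e_L)$ be a left quasigroup with a unit, $H=L$, let $G$ be a group with a bijection of sets $\pi:L\to G$, let $(L,m,\eta,\sigma)$ be the associated structure in $\mathrm{Set}_H$ (see context), and let $(X,m_X)$ be a left $(L,m,\eta)$-module in $\mathrm{Set}_H$. Let $\lambda_0\in L$ be the unique element such that $\pi(\lambda_0)$ is the unit of $G$, and let $\{f^{\lambda_0}_x:G\to G\mid x\in X\}$ be any family of group homomorphisms. Set $Y=L\otimes X$ and define $m_Y:L\otimes Y\to Y$ from this family as in the context. Then $$k=m_Y\big(1_L\otimes((\eta\otimes1_X)l_X^{-1})\big):L\otimes X\to L\otimes X,\qquad\text{i.e. } k(\lambda)(a,x)=m_Y(\lambda)(a,(e_L,x)),$$ is a dynamical reflection map associated with $\sigma$; that is, $k$ is a morphism of $\mathrm{Set}_H$ satisfying the reflection equation $$a_{LLX}^{-1}(1_L\otimes k)a_{LLX}(\sigma\otimes1_X)a_{LLX}^{-1}(1_L\otimes k)a_{LLX}(\sigma\otimes1_X)a_{LLX}^{-1}$$ $$=(\sigma\otimes1_X)a_{LLX}^{-1}(1_L\otimes k)a_{LLX}(\sigma\otimes1_X)a_{LLX}^{-1}(1_L\otimes k).$$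
   Context: Category $\mathrm{Set}_H$ ($H$ a nonempty set): objects are pairs $(X,\cdot_X)$ of a set $X$ and a map $\cdot_X:H\times X\to H$. A morphism $f:X\to Y$ is a map $f:H\to\mathrm{Map}(X,Y)$ with $\lambda\cdot_Yf(\lambda)(x)=\lambda\cdot_Xx$ for all $\lambda,x$; composition is $(gf)(\lambda)=g(\lambda)\circ f(\lambda)$. It is a tensor (monoidal) category: $X\otimes Y=X\times Y$ with $\lambda\cdot_{X\otimes Y}(x,y)=(\lambda\cdot_Xx)\cdot_Yy$; $(f\otimes g)(\lambda)(x,y)=(f(\lambda)(x),g(\lambda\cdot_Xx)(y))$; unit $I=\{\bullet\}$ with $\lambda\cdot_I\bullet=\lambda$; constraints $a_{XYZ}(\lambda)((x,y),z)=(x,(y,z))$, $l_X(\lambda)(\bullet,x)=x$, $r_X(\lambda)(x,\bullet)=x$. Left quasigroup with a unit $(L,\cdot,e_L)$: a set with a binary operation $(a,b)\mapsto ab$ such that for all $a,c\in L$ there is a unique $b\in L$ with $ab=c$ (denoted $b=a\backslash c$), and $ae_L=e_La=a$ for all $a$. With $H=L$, $L$ is an object of $\mathrm{Set}_H$ via its own operation. Structure on $L$ ($\lambda\in H$, $a,b\in L$): $m(\lambda)(a,b)=\lambda\backslash((\lambda a)b)$, $\eta(\lambda)(\bullet)=e_L$, $\sigma(\lambda)(a,b)=(\xi_\lambda(a,b),\eta_\lambda(a,b))$ with $\xi_\lambda(a,b)=\lambda\backslash\pi^{-1}(\pi(\lambda)\pi(\lambda a)^{-1}\pi((\lambda a)b))$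 and $\eta_\lambda(a,b)=(\lambda\xi_\lambda(a,b))\backslash((\lambda a)b)$. These are morphisms of $\mathrm{Set}_H$. Left $(L,m,\eta)$-module $(X,m_X)$ in $\mathrm{Set}_H$: a morphism $m_X:L\otimes X\to X$ with $m_X(\lambda)(\lambda\backslash((\lambda a)b),x)=m_X(\lambda)(a,m_X(\lambda a)(b,x))$ and $m_X(\lambda)(e_L,x)=x$. Definition of $m_Y$ from $\{f^{\lambda_0}_x\}$: for $\lambda\in H$, $a,b\in L$, $x\in X$ put $$a\,\square^{\lambda}_{x}\,b=\lambda\backslash\pi^{-1}\Big(\pi(\lambda a)\pi(\lambda)^{-1}\pi(\lambda b)\,f^{\lambda_0}_{m_X(\lambda_0)(\lambda_0\backslash\lambda,x)}(\pi(\lambda))\,f^{\lambda_0}_{m_X(\lambda_0)(\lambda_0\backslash\lambda,x)}(\pi(\lambda a))^{-1}\Big),$$ $$m_Y(\lambda)(a,(b,x))=\big(\lambda\backslash c,\;m_X(c)(c\backslash(\lambda a),m_X(\lambda a)(b,x))\big),\quad c=(\lambda a)\big(((\lambda a)\backslash\lambda)\,\square^{\lambda a}_{m_X(\lambda a)(b,x)}\,b\big).$$ *)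

theory Defs
  imports "HOL-Algebra.Group"
begin

section \<open>The tensor category Set\<open>_\<close>H\<close>

text \<open>
  Everything is relative to carrier sets (so the set underlying an object may be empty).  A morphism is a
  function \<open>'h \<Rightarrow> 'x \<Rightarrow> 'y\<close> of which only the values at \<open>h \<in> H\<close>, \<open>x \<in> carrier X\<close> matter; two parallel
  morphisms are equal when they agree on these arguments (\<open>mor_eq\<close>).
  Elements of \<open>H\<close>, usually called lambda, are written \<open>h\<close>.
\<close>

record ('x, 'h) dset = "'x partial_object" +
  act :: "'h \<Rightarrow> 'x \<Rightarrow> 'h"

type_synonym ('h, 'x, 'y) dmor = "'h \<Rightarrow> 'x \<Rightarrow> 'y"

definition is_object :: "'h set \<Rightarrow> ('x, 'h) dset \<Rightarrow> bool" where
  "is_object H X \<longleftrightarrow> (\<forall>h\<in>H. \<forall>x\<in>carrier X. act X h x \<in> H)"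

definition hom_set :: "'h set \<Rightarrow> ('x, 'h) dset \<Rightarrow> ('y, 'h) dset \<Rightarrow> ('h, 'x, 'y) dmor set" where
  "hom_set H X Y = {f. \<forall>h\<in>H. \<forall>x\<in>carrier X.
     f h x \<in> carrier Y \<and> act Y h (f h x) = act X h x}"

definition mor_eq :: "'h set \<Rightarrow> ('x, 'h) dset \<Rightarrow> ('h, 'x, 'y) dmor \<Rightarrow> ('h, 'x, 'y) dmor \<Rightarrow> bool" where
  "mor_eq H X f g \<longleftrightarrow> (\<forall>h\<in>H. \<forall>x\<in>carrier X. f h x = g h x)"

definition id_mor :: "('h, 'x, 'x) dmor" where
  "id_mor h x = x"

definition comp_mor :: "('h, 'y, 'z) dmor \<Rightarrow> ('h, 'x, 'y) dmor \<Rightarrow> ('h, 'x, 'z) dmor"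
    (infixl "\<bullet>" 70) where
  "(g \<bullet> f) h = g h \<circ> f h"

definition tensor_obj :: "('x, 'h) dset \<Rightarrow> ('y, 'h) dset \<Rightarrow> ('x \<times> 'y, 'h) dset"
    (infixr "\<otimes>\<^sub>o" 75) where
  "X \<otimes>\<^sub>o Y = \<lparr>carrier = carrier X \<times> carrier Y,
              act = (\<lambda>h (x, y). act Y (act X h x) y)\<rparr>"

text \<open>The first argument is the source object of \<open>f\<close>, whose action enters the formula.\<close>

definition tensor_mor ::
    "('x, 'h) dset \<Rightarrow> ('h, 'x, 'x1) dmor \<Rightarrow> ('h, 'y, 'y1) dmor \<Rightarrow> ('h, 'x \<times> 'y, 'x1 \<times> 'y1) dmor" where
  "tensor_mor X f g h = (\<lambda>(x, y). (f h x, g (act X h x) y))"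

definition unit_obj :: "(unit, 'h) dset" where
  "unit_obj = \<lparr>carrier = {()}, act = (\<lambda>h _. h)\<rparr>"

definition assoc :: "('h, ('x \<times> 'y) \<times> 'z, 'x \<times> ('y \<times> 'z)) dmor" where
  "assoc h = (\<lambda>((x, y), z). (x, (y, z)))"

definition assoc_inv :: "('h, 'x \<times> ('y \<times> 'z), ('x \<times> 'y) \<times> 'z) dmor" where
  "assoc_inv h = (\<lambda>(x, (y, z)). ((x, y), z))"

definition lunit :: "('h, unit \<times> 'x, 'x) dmor" where
  "lunit h = (\<lambda>(_, x). x)"

definition lunit_inv :: "('h, 'x, unit \<times> 'x) dmor" where
  "lunit_inv h x = ((), x)"

lemma assoc_inverse: "assoc \<bullet> assoc_inv = id_mor" "assoc_inv \<bullet> assoc = id_mor"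
  by (auto simp: fun_eq_iff comp_mor_def assoc_def assoc_inv_def id_mor_def)

lemma lunit_inverse: "lunit \<bullet> lunit_inv = id_mor" "lunit_inv \<bullet> lunit = id_mor"
  by (auto simp: fun_eq_iff comp_mor_def lunit_def lunit_inv_def id_mor_def)

definition reflection_map ::
    "'h set \<Rightarrow> ('l, 'h) dset \<Rightarrow> ('x, 'h) dset \<Rightarrow> ('h, 'l \<times> 'l, 'l \<times> 'l) dmor
      \<Rightarrow> ('h, 'l \<times> 'x, 'l \<times> 'x) dmor \<Rightarrow> bool" where
  "reflection_map H L X \<sigma> k \<longleftrightarrow>
     k \<in> hom_set H (L \<otimes>\<^sub>o X) (L \<otimes>\<^sub>o X) \<and>
     (let S = tensor_mor (L \<otimes>\<^sub>o L) \<sigma> id_mor; K = tensor_mor L id_mor k in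
      mor_eq H (L \<otimes>\<^sub>o (L \<otimes>\<^sub>o X))
        (assoc_inv \<bullet> K \<bullet> assoc \<bullet> S \<bullet> assoc_inv \<bullet> K \<bullet> assoc \<bullet> S \<bullet> assoc_inv)
        (S \<bullet> assoc_inv \<bullet> K \<bullet> assoc \<bullet> S \<bullet> assoc_inv \<bullet> K))"


section \<open>Left quasigroups with a unit\<close>

locale left_quasigroup_unit =
  fixes L (structure)
  assumes mult_closed: "\<lbrakk>a \<in> carrier L; b \<in> carrier L\<rbrakk> \<Longrightarrow> a \<otimes> b \<in> carrier L"
    and left_div_ex1: "\<lbrakk>a \<in> carrier L; c \<in> carrier L\<rbrakk> \<Longrightarrow> \<exists>!b. b \<in> carrier L \<and> a \<otimes> b = c"
    and unit_closed: "\<one> \<in> carrier L"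
    and right_unit: "a \<in> carrier L \<Longrightarrow> a \<otimes> \<one> = a"
    and left_unit: "a \<in> carrier L \<Longrightarrow> \<one> \<otimes> a = a"

definition left_div :: "('l, 'm) monoid_scheme \<Rightarrow> 'l \<Rightarrow> 'l \<Rightarrow> 'l" where
  "left_div L a c = (THE b. b \<in> carrier L \<and> a \<otimes>\<^bsub>L\<^esub> b = c)"

text \<open>From here on \<open>H = L\<close>.\<close>

definition quasi_obj :: "('l, 'm) monoid_scheme \<Rightarrow> ('l, 'l) dset" where
  "quasi_obj L = \<lparr>carrier = carrier L, act = mult L\<rparr>"

definition quasi_mult :: "('l, 'm) monoid_scheme \<Rightarrow> ('l, 'l \<times> 'l, 'l) dmor" where
  "quasi_mult L h = (\<lambda>(a, b). left_div L h ((h \<otimes>\<^bsub>L\<^esub> a) \<otimes>\<^bsub>L\<^esub> b))"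

definition quasi_unit :: "('l, 'm) monoid_scheme \<Rightarrow> ('l, unit, 'l) dmor" where
  "quasi_unit L h u = \<one>\<^bsub>L\<^esub>"

definition left_module :: "('l, 'm) monoid_scheme \<Rightarrow> ('x, 'l) dset \<Rightarrow> ('l, 'l \<times> 'x, 'x) dmor \<Rightarrow> bool" where
  "left_module L X m\<^sub>X \<longleftrightarrow>
     is_object (carrier L) X \<and>
     m\<^sub>X \<in> hom_set (carrier L) (quasi_obj L \<otimes>\<^sub>o X) X \<and>
     (\<forall>h\<in>carrier L. \<forall>a\<in>carrier L. \<forall>b\<in>carrier L. \<forall>x\<in>carrier X.
        m\<^sub>X h (quasi_mult L h (a, b), x) = m\<^sub>X h (a, m\<^sub>X (h \<otimes>\<^bsub>L\<^esub> a) (b, x))) \<and>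
     (\<forall>h\<in>carrier L. \<forall>x\<in>carrier X. m\<^sub>X h (quasi_unit L h (), x) = x)"


section \<open>The structure induced by a bijection onto a group\<close>

definition xi :: "('l, 'm) monoid_scheme \<Rightarrow> ('g, 'n) monoid_scheme \<Rightarrow> ('l \<Rightarrow> 'g) \<Rightarrow> 'l \<Rightarrow> 'l \<Rightarrow> 'l \<Rightarrow> 'l" where
  "xi L G \<pi> h a b = left_div L h (inv_into (carrier L) \<pi>
     (\<pi> h \<otimes>\<^bsub>G\<^esub> inv\<^bsub>G\<^esub> \<pi> (h \<otimes>\<^bsub>L\<^esub> a) \<otimes>\<^bsub>G\<^esub> \<pi> ((h \<otimes>\<^bsub>L\<^esub> a) \<otimes>\<^bsub>L\<^esub> b)))"

definition eta :: "('l, 'm) monoid_scheme \<Rightarrow> ('g, 'n) monoid_scheme \<Rightarrow> ('l \<Rightarrow> 'g) \<Rightarrow> 'l \<Rightarrow> 'l \<Rightarrow> 'l \<Rightarrow> 'l" where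
  "eta L G \<pi> h a b = left_div L (h \<otimes>\<^bsub>L\<^esub> xi L G \<pi> h a b) ((h \<otimes>\<^bsub>L\<^esub> a) \<otimes>\<^bsub>L\<^esub> b)"

definition quasi_sigma ::
    "('l, 'm) monoid_scheme \<Rightarrow> ('g, 'n) monoid_scheme \<Rightarrow> ('l \<Rightarrow> 'g) \<Rightarrow> ('l, 'l \<times> 'l, 'l \<times> 'l) dmor" where
  "quasi_sigma L G \<pi> h = (\<lambda>(a, b). (xi L G \<pi> h a b, eta L G \<pi> h a b))"

definition square ::
    "('l, 'm) monoid_scheme \<Rightarrow> ('g, 'n) monoid_scheme \<Rightarrow> ('l \<Rightarrow> 'g) \<Rightarrow> ('l, 'l \<times> 'x, 'x) dmor
      \<Rightarrow> 'l \<Rightarrow> ('x \<Rightarrow> 'g \<Rightarrow> 'g) \<Rightarrow> 'l \<Rightarrow> 'x \<Rightarrow> 'l \<Rightarrow> 'l \<Rightarrow> 'l" where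
  "square L G \<pi> m\<^sub>X h\<^sub>0 f h x a b =
     (let F = f (m\<^sub>X h\<^sub>0 (left_div L h\<^sub>0 h, x)) in
      left_div L h (inv_into (carrier L) \<pi>
        (\<pi> (h \<otimes>\<^bsub>L\<^esub> a) \<otimes>\<^bsub>G\<^esub> inv\<^bsub>G\<^esub> \<pi> h \<otimes>\<^bsub>G\<^esub> \<pi> (h \<otimes>\<^bsub>L\<^esub> b)
           \<otimes>\<^bsub>G\<^esub> F (\<pi> h) \<otimes>\<^bsub>G\<^esub> inv\<^bsub>G\<^esub> F (\<pi> (h \<otimes>\<^bsub>L\<^esub> a)))))"

definition m_Y ::
    "('l, 'm) monoid_scheme \<Rightarrow> ('g, 'n) monoid_scheme \<Rightarrow> ('l \<Rightarrow> 'g) \<Rightarrow> ('l, 'l \<times> 'x, 'x) dmor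
      \<Rightarrow> 'l \<Rightarrow> ('x \<Rightarrow> 'g \<Rightarrow> 'g) \<Rightarrow> ('l, 'l \<times> ('l \<times> 'x), 'l \<times> 'x) dmor" where
  "m_Y L G \<pi> m\<^sub>X h\<^sub>0 f h = (\<lambda>(a, (b, x)).
     let \<mu> = h \<otimes>\<^bsub>L\<^esub> a;
         y = m\<^sub>X \<mu> (b, x);
         c = \<mu> \<otimes>\<^bsub>L\<^esub> square L G \<pi> m\<^sub>X h\<^sub>0 f \<mu> y (left_div L \<mu> h) b
     in (left_div L h c, m\<^sub>X c (left_div L c \<mu>, y)))"

definition reflection_k ::
    "('l, 'm) monoid_scheme \<Rightarrow> ('g, 'n) monoid_scheme \<Rightarrow> ('l \<Rightarrow> 'g) \<Rightarrow> ('l, 'l \<times> 'x, 'x) dmor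
      \<Rightarrow> 'l \<Rightarrow> ('x \<Rightarrow> 'g \<Rightarrow> 'g) \<Rightarrow> ('l, 'l \<times> 'x, 'l \<times> 'x) dmor" where
  "reflection_k L G \<pi> m\<^sub>X h\<^sub>0 f =
     m_Y L G \<pi> m\<^sub>X h\<^sub>0 f \<bullet>
       tensor_mor (quasi_obj L) id_mor (tensor_mor unit_obj (quasi_unit L) id_mor \<bullet> lunit_inv)"

lemma reflection_k_apply:
  "reflection_k L G \<pi> m\<^sub>X h\<^sub>0 f h (a, x) = m_Y L G \<pi> m\<^sub>X h\<^sub>0 f h (a, (\<one>\<^bsub>L\<^esub>, x))"
  by (simp add: reflection_k_def comp_mor_def tensor_mor_def id_mor_def lunit_inv_def
      quasi_unit_def unit_obj_def)

end

theory Submission imports Defs begin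

text \<open>
  The fibres of \<open>X\<close> over the points of \<open>L\<close> are identified with one another by the transport
  \<open>T(p, q)(x) = m\<^sub>X p (p \ q, x)\<close>, for which the module axioms say \<open>T(p, q) T(q, r) = T(p, r)\<close>
  and \<open>T(p, p) = id\<close>.  Describe an element \<open>(a, (b, x))\<close> over \<open>h\<close> by the group elements
  \<open>g\<^sub>0 = \<pi>(h)\<close>, \<open>g\<^sub>1 = \<pi>(ha)\<close>, \<open>g\<^sub>2 = \<pi>((ha)b)\<close> and by \<open>z = T(h\<^sub>0, (ha)b)(x)\<close>.
  In these coordinates \<open>z\<close> is constant, \<open>\<sigma>\<close> replaces \<open>g\<^sub>1\<close> by \<open>g\<^sub>0 g\<^sub>1\<inverse> g\<^sub>2\<close> and \<open>k\<close>
  replaces \<open>g\<^sub>2\<close> by \<open>g\<^sub>1 \<phi>(g\<^sub>2) \<phi>(g\<^sub>1)\<inverse>\<close> with the homomorphism \<open>\<phi> = f\<^sub>z\<close>.  Both sides of the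
  reflection equation then become \<open>(g\<^sub>0, g\<^sub>0 \<phi>(g\<^sub>1 g\<^sub>0\<inverse>), g\<^sub>0 \<phi>(g\<^sub>2 g\<^sub>0\<inverse>))\<close>.
\<close>

context left_quasigroup_unit
begin

lemma left_div_props:
  assumes "a \<in> carrier L" "c \<in> carrier L"
  shows left_div_closed: "left_div L a c \<in> carrier L"
    and mult_left_div: "a \<otimes> left_div L a c = c"
  using theI'[OF left_div_ex1[OF assms]] unfolding left_div_def by auto

lemma left_div_unique:
  assumes "a \<in> carrier L" "b \<in> carrier L" "a \<otimes> b = c"
  shows "left_div L a c = b"
  using assms left_div_ex1[of a c] left_div_props[of a c] mult_closed[of a b] by blast

lemma left_div_mult: "\<lbrakk>a \<in> carrier L; b \<in> carrier L\<rbrakk> \<Longrightarrow> left_div L a (a \<otimes> b) = b"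
  by (simp add: left_div_unique)

lemma left_div_self: "a \<in> carrier L \<Longrightarrow> left_div L a a = \<one>"
  by (simp add: left_div_unique unit_closed right_unit)

end

context group
begin

lemma mult_inv_cancel: "\<lbrakk>x \<in> carrier G; y \<in> carrier G\<rbrakk> \<Longrightarrow> x \<otimes> (inv x \<otimes> y) = y"
  by (simp flip: m_assoc)

lemma inv_mult_cancel: "\<lbrakk>x \<in> carrier G; y \<in> carrier G\<rbrakk> \<Longrightarrow> inv x \<otimes> (x \<otimes> y) = y"
  by (simp flip: m_assoc)

lemma hom_inv_self:
  assumes "\<phi> \<in> hom G G" "x \<in> carrier G"
  shows "\<phi> (inv x) = inv \<phi> x"
  using group_hom.hom_inv[of G G \<phi> x] assms is_group
  by (simp add: group_hom_def group_hom_axioms_def)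

end

locale module_over_group_bijection =
  left_quasigroup_unit L + G: group G
  for L :: "('l, 'm) monoid_scheme" (structure) and G :: "('g, 'n) monoid_scheme" +
  fixes \<pi> :: "'l \<Rightarrow> 'g" and X :: "('x, 'l) dset" and m\<^sub>X :: "('l, 'l \<times> 'x, 'x) dmor"
    and h\<^sub>0 :: 'l and f :: "'x \<Rightarrow> 'g \<Rightarrow> 'g"
  assumes bij: "bij_betw \<pi> (carrier L) (carrier G)"
    and module: "left_module L X m\<^sub>X"
    and base: "h\<^sub>0 \<in> carrier L"
    and f_hom: "x \<in> carrier X \<Longrightarrow> f x \<in> hom G G"
begin

definition point :: "'g \<Rightarrow> 'l" where
  "point = inv_into (carrier L) \<pi>"

definition transport :: "'l \<Rightarrow> 'l \<Rightarrow> 'x \<Rightarrow> 'x" where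
  "transport p q x = m\<^sub>X p (left_div L p q, x)"

lemma pi_closed: "p \<in> carrier L \<Longrightarrow> \<pi> p \<in> carrier G"
  using bij by (auto simp: bij_betw_def)

lemma point_closed: "g \<in> carrier G \<Longrightarrow> point g \<in> carrier L"
  unfolding point_def by (metis bij bij_betw_def inv_into_into)

lemma pi_point: "g \<in> carrier G \<Longrightarrow> \<pi> (point g) = g"
  unfolding point_def by (metis bij bij_betw_def f_inv_into_f)

lemma point_pi: "p \<in> carrier L \<Longrightarrow> point (\<pi> p) = p"
  unfolding point_def by (metis bij bij_betw_def inv_into_f_f)

lemma transport_closed:
  "\<lbrakk>p \<in> carrier L; q \<in> carrier L; x \<in> carrier X\<rbrakk> \<Longrightarrow> transport p q x \<in> carrier X"
  using module left_div_closed[of p q]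
  by (auto simp: transport_def left_module_def hom_set_def tensor_obj_def quasi_obj_def)

lemma act_transport:
  "\<lbrakk>p \<in> carrier L; q \<in> carrier L; x \<in> carrier X\<rbrakk> \<Longrightarrow> act X p (transport p q x) = act X q x"
  using module left_div_props[of p q]
  by (auto simp: transport_def left_module_def hom_set_def tensor_obj_def quasi_obj_def)

lemma transport_refl: "\<lbrakk>p \<in> carrier L; x \<in> carrier X\<rbrakk> \<Longrightarrow> transport p p x = x"
  using module by (auto simp: transport_def left_module_def quasi_unit_def left_div_self)

text \<open>Associativity of the module at \<open>?a\<close>, \<open>?b\<close>: since
  \<open>(p \<otimes> ?a) \<otimes> ?b = r\<close>, the product
  \<open>quasi_mult L p (?a, ?b)\<close> is \<open>left_div L p r\<close>.\<close>

lemma transport_trans: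
  assumes "p \<in> carrier L" "q \<in> carrier L" "r \<in> carrier L" "x \<in> carrier X"
  shows "transport p q (transport q r x) = transport p r x"
proof -
  let ?a = "left_div L p q" and ?b = "left_div L q r"
  have "m\<^sub>X p (quasi_mult L p (?a, ?b), x) = m\<^sub>X p (?a, m\<^sub>X (p \<otimes> ?a) (?b, x))"
    using module assms left_div_closed unfolding left_module_def by blast
  then show ?thesis
    using assms by (simp add: transport_def quasi_mult_def mult_left_div)
qed

text \<open>The module component is recorded by \<open>z\<close> over the fixed point
  \<open>h\<^sub>0\<close>, so that it need not change when \<open>point g'\<close> moves.\<close>

definition pair_at :: "'g \<Rightarrow> 'g \<Rightarrow> 'x \<Rightarrow> 'l \<times> 'x" where
  "pair_at g g' z =
     (left_div L (point g) (point g'), transport (point g') h\<^sub>0 z)"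

definition triple_at :: "'g \<Rightarrow> 'g \<Rightarrow> 'g \<Rightarrow> 'x \<Rightarrow> 'l \<times> 'l \<times> 'x" where
  "triple_at g g' g'' z = (left_div L (point g) (point g'), pair_at g' g'' z)"

lemma pair_at_closed:
  "\<lbrakk>g \<in> carrier G; g' \<in> carrier G; z \<in> carrier X\<rbrakk> \<Longrightarrow> pair_at g g' z \<in> carrier L \<times> carrier X"
  by (simp add: pair_at_def left_div_closed transport_closed point_closed base)

text \<open>Coordinates reach every element, so it suffices to check identities on them;
  \<open>z\<close> comes from transporting \<open>x\<close> to \<open>h\<^sub>0\<close>.\<close>

lemma pair_atE:
  assumes "h \<in> carrier L" "a \<in> carrier L" "x \<in> carrier X"
  obtains g g' z where "g \<in> carrier G" "g' \<in> carrier G" "z \<in> carrier X"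
    "h = point g" "(a, x) = pair_at g g' z"
proof
  show "(a, x) = pair_at (\<pi> h) (\<pi> (h \<otimes> a)) (transport h\<^sub>0 (h \<otimes> a) x)"
    using assms by (simp add: pair_at_def point_pi mult_closed left_div_mult transport_trans
        transport_refl base)
qed (use assms in \<open>simp_all add: pi_closed point_pi mult_closed transport_closed base\<close>)

lemma triple_atE:
  assumes "h \<in> carrier L" "a \<in> carrier L" "b \<in> carrier L" "x \<in> carrier X"
  obtains g g' g'' z where "g \<in> carrier G" "g' \<in> carrier G" "g'' \<in> carrier G" "z \<in> carrier X"
    "h = point g" "(a, b, x) = triple_at g g' g'' z"
proof -
  \<comment> \<open>The tail \<open>(b, x)\<close> lies over \<open>h \<otimes> a\<close>, so its
    coordinates start there.\<close>
  obtain g' g'' z where *: "g' \<in> carrier G" "g'' \<in> carrier G" "z \<in> carrier X"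
    "h \<otimes> a = point g'" "(b, x) = pair_at g' g'' z"
    using pair_atE[of "h \<otimes> a" b x] assms mult_closed by metis
  show thesis
  proof (rule that[of "\<pi> h" g' g'' z])
    show "(a, b, x) = triple_at (\<pi> h) g' g'' z"
      using assms * left_div_mult[of h a] by (simp add: triple_at_def point_pi)
  qed (use assms * in \<open>simp_all add: pi_closed point_pi\<close>)
qed

abbreviation "k \<equiv> reflection_k L G \<pi> m\<^sub>X h\<^sub>0 f"

text \<open>With the unit of \<open>L\<close> as second argument of \<open>square\<close>, the
  factors \<open>inv g'\<close> and \<open>g'\<close> cancel and only \<open>g\<close> remains in
  front of the values of \<open>f z\<close>.\<close>

lemma k_pair_at:
  assumes "g \<in> carrier G" "g' \<in> carrier G" "z \<in> carrier X"
  shows "k (point g) (pair_at g g' z) =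
    pair_at g (g \<otimes>\<^bsub>G\<^esub> f z g' \<otimes>\<^bsub>G\<^esub> inv\<^bsub>G\<^esub> f z g) z"
proof -
  let ?h = "point g" and ?p = "point g'" and ?x = "transport (point g') h\<^sub>0 z"
  let ?c = "point (g \<otimes>\<^bsub>G\<^esub> f z g' \<otimes>\<^bsub>G\<^esub> inv\<^bsub>G\<^esub> f z g)"
  have h: "?h \<in> carrier L" and p: "?p \<in> carrier L"
    using assms by (auto intro: point_closed)
  have F: "f z g \<in> carrier G" "f z g' \<in> carrier G"
    using assms hom_in_carrier[OF f_hom] by auto
  have c: "?c \<in> carrier L"
    using assms F by (intro point_closed) auto
  have x: "?x \<in> carrier X"
    using assms p by (simp add: transport_closed base)
  have x1: "m\<^sub>X ?p (\<one>, ?x) = ?x"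
    using transport_refl[OF p x] p by (simp add: transport_def left_div_self)
  \<comment> \<open>This is the index of the homomorphism inside \<open>square\<close>.\<close>
  have z: "m\<^sub>X h\<^sub>0 (left_div L h\<^sub>0 ?p, ?x) = z"
    using assms p by (simp flip: transport_def add: transport_trans transport_refl base)
  have "square L G \<pi> m\<^sub>X h\<^sub>0 f ?p ?x (left_div L ?p ?h) \<one> = left_div L ?p ?c"
    using assms h p z F by (simp flip: point_def add: square_def Let_def right_unit mult_left_div pi_point
        G.m_assoc G.inv_mult_cancel)
  then have "k ?h (pair_at g g' z) = (left_div L ?h ?c, transport ?c ?p ?x)"
    using h p c x1
    by (simp add: reflection_k_apply m_Y_def Let_def pair_at_def mult_left_div transport_def)
  then show ?thesis
    using assms p c by (simp add: pair_at_def transport_trans base)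
qed

definition "K = tensor_mor (quasi_obj L) id_mor k"

text \<open>Conjugation by the associator makes \<sigma> act on the right-nested triples on which
  \<open>K\<close> acts.\<close>

definition "S = assoc \<bullet> tensor_mor (quasi_obj L \<otimes>\<^sub>o quasi_obj L) (quasi_sigma L G \<pi>) id_mor \<bullet> assoc_inv"

lemma K_triple_at:
  assumes "g \<in> carrier G" "g' \<in> carrier G" "g'' \<in> carrier G" "z \<in> carrier X"
  shows "K (point g) (triple_at g g' g'' z) =
    triple_at g g' (g' \<otimes>\<^bsub>G\<^esub> f z g'' \<otimes>\<^bsub>G\<^esub> inv\<^bsub>G\<^esub> f z g') z"
  using assms by (simp add: K_def tensor_mor_def triple_at_def id_mor_def quasi_obj_def mult_left_div
      point_closed k_pair_at)

text \<open>\<open>xi\<close> leads from \<open>point g\<close> to the new middle point and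
  \<open>eta\<close> from there to the old end point, so the module component stays over the same
  point.\<close>

lemma S_triple_at:
  assumes "g \<in> carrier G" "g' \<in> carrier G" "g'' \<in> carrier G" "z \<in> carrier X"
  shows "S (point g) (triple_at g g' g'' z) =
    triple_at g (g \<otimes>\<^bsub>G\<^esub> inv\<^bsub>G\<^esub> g' \<otimes>\<^bsub>G\<^esub> g'') g'' z"
  using assms by (simp flip: point_def add: S_def comp_mor_def assoc_def assoc_inv_def tensor_mor_def
      triple_at_def pair_at_def id_mor_def quasi_sigma_def xi_def eta_def mult_left_div
      point_closed pi_point)

lemma k_in_hom_set: "k \<in> hom_set (carrier L) (quasi_obj L \<otimes>\<^sub>o X) (quasi_obj L \<otimes>\<^sub>o X)"
proof -
  let ?Y = "quasi_obj L \<otimes>\<^sub>o X"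
  \<comment> \<open>The action sees only \<open>z\<close>, which \<open>k\<close> preserves; this
    gives the morphism condition.\<close>
  have act_pair: "act ?Y (point g) (pair_at g g' z) = act X h\<^sub>0 z"
    if "g \<in> carrier G" "g' \<in> carrier G" "z \<in> carrier X" for g g' z
    using that by (simp add: tensor_obj_def quasi_obj_def pair_at_def mult_left_div point_closed
        act_transport base)
  have "k h (a, x) \<in> carrier ?Y \<and> act ?Y h (k h (a, x)) = act ?Y h (a, x)"
    if hax: "h \<in> carrier L" "a \<in> carrier L" "x \<in> carrier X" for h a x
  proof -
    obtain g g' z where *: "g \<in> carrier G" "g' \<in> carrier G" "z \<in> carrier X"
      "h = point g" "(a, x) = pair_at g g' z"
      using pair_atE[OF hax] by blast
    have "g \<otimes>\<^bsub>G\<^esub> f z g' \<otimes>\<^bsub>G\<^esub> inv\<^bsub>G\<^esub> f z g \<in> carrier G"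
      using * hom_in_carrier[OF f_hom] by simp
    moreover from this have "pair_at g (g \<otimes>\<^bsub>G\<^esub> f z g' \<otimes>\<^bsub>G\<^esub> inv\<^bsub>G\<^esub> f z g) z \<in> carrier ?Y"
      using pair_at_closed * by (simp add: tensor_obj_def quasi_obj_def)
    ultimately show ?thesis
      unfolding *(4,5) k_pair_at[OF *(1-3)] using * by (simp add: act_pair)
  qed
  then show ?thesis
    by (auto simp: hom_set_def tensor_obj_def quasi_obj_def)
qed

text \<open>Multiplicativity of \<open>f z\<close> splits its values on products; all nested values
  \<open>f z (f z u)\<close> then cancel on both sides.\<close>

lemma reflection_equation_triple_at:
  assumes g: "g \<in> carrier G" "g' \<in> carrier G" "g'' \<in> carrier G" and z: "z \<in> carrier X"
  defines "h \<equiv> point g" and "t \<equiv> triple_at g g' g'' z"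
  shows "K h (S h (K h (S h t))) = S h (K h (S h (K h t)))"
proof -
  note f = f_hom[OF z]
  have F: "f z u \<in> carrier G" if "u \<in> carrier G" for u
    using hom_in_carrier[OF f that] .
  \<comment> \<open>Products are nested to the right with inverses and \<open>f z\<close>
    distributed over factors, so the cancellation rules apply inside longer products.\<close>
  note simps = h_def t_def S_triple_at K_triple_at G.m_assoc G.inv_mult_group hom_mult[OF f]
    G.hom_inv_self[OF f] G.mult_inv_cancel G.inv_mult_cancel
  have "K h (S h (K h (S h t))) = triple_at g (g \<otimes>\<^bsub>G\<^esub> f z g' \<otimes>\<^bsub>G\<^esub> inv\<^bsub>G\<^esub> f z g)
      (g \<otimes>\<^bsub>G\<^esub> f z g'' \<otimes>\<^bsub>G\<^esub> inv\<^bsub>G\<^esub> f z g) z"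
    using g z F by (simp add: simps)
  moreover have "S h (K h (S h (K h t))) = triple_at g (g \<otimes>\<^bsub>G\<^esub> f z g' \<otimes>\<^bsub>G\<^esub> inv\<^bsub>G\<^esub> f z g)
      (g \<otimes>\<^bsub>G\<^esub> f z g'' \<otimes>\<^bsub>G\<^esub> inv\<^bsub>G\<^esub> f z g) z"
    using g z F by (simp add: simps)
  ultimately show ?thesis by simp
qed

lemma reflection_map_k: "reflection_map (carrier L) (quasi_obj L) X (quasi_sigma L G \<pi>) k"
proof -
  let ?S = "tensor_mor (quasi_obj L \<otimes>\<^sub>o quasi_obj L) (quasi_sigma L G \<pi>) id_mor"
  have lhs: "(assoc_inv \<bullet> K \<bullet> assoc \<bullet> ?S \<bullet> assoc_inv \<bullet> K \<bullet> assoc \<bullet> ?S \<bullet> assoc_inv) h t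
      = assoc_inv h (K h (S h (K h (S h t))))" for h t
    by (simp add: S_def comp_mor_def)
  \<comment> \<open>No associator follows the leftmost \<open>?S\<close>; the outer
    \<open>assoc_inv\<close> undoes the one contained in \<open>S\<close>.\<close>
  have rhs: "(?S \<bullet> assoc_inv \<bullet> K \<bullet> assoc \<bullet> ?S \<bullet> assoc_inv \<bullet> K) h t
      = assoc_inv h (S h (K h (S h (K h t))))" for h t
    by (simp add: S_def comp_mor_def assoc_def assoc_inv_def split_beta)
  have "K h (S h (K h (S h (a, b, x)))) = S h (K h (S h (K h (a, b, x))))"
    if hyp: "h \<in> carrier L" "a \<in> carrier L" "b \<in> carrier L" "x \<in> carrier X" for h a b x
  proof -
    obtain g g' g'' z where *: "g \<in> carrier G" "g' \<in> carrier G" "g'' \<in> carrier G"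
      "z \<in> carrier X" "h = point g" "(a, b, x) = triple_at g g' g'' z"
      using triple_atE[OF hyp] by blast
    show ?thesis
      unfolding *(5,6) by (rule reflection_equation_triple_at[OF *(1-4)])
  qed
  then show ?thesis
    unfolding reflection_map_def Let_def mor_eq_def K_def[symmetric] lhs rhs
    using k_in_hom_set by (simp add: tensor_obj_def quasi_obj_def)
qed

end

theorem mainTheorem2:
  fixes L :: "('l, 'm) monoid_scheme" and G :: "('g, 'n) monoid_scheme"
    and \<pi> :: "'l \<Rightarrow> 'g" and X :: "('x, 'l) dset" and m\<^sub>X :: "('l, 'l \<times> 'x, 'x) dmor"
    and h\<^sub>0 :: 'l and f :: "'x \<Rightarrow> 'g \<Rightarrow> 'g"
  assumes "left_quasigroup_unit L"
    and "group G"
    and "bij_betw \<pi> (carrier L) (carrier G)"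
    and "left_module L X m\<^sub>X"
    and "h\<^sub>0 \<in> carrier L" and "\<pi> h\<^sub>0 = \<one>\<^bsub>G\<^esub>"
    and "\<And>x. x \<in> carrier X \<Longrightarrow> f x \<in> hom G G"
  shows "reflection_map (carrier L) (quasi_obj L) X (quasi_sigma L G \<pi>)
           (reflection_k L G \<pi> m\<^sub>X h\<^sub>0 f)"
proof -
  interpret module_over_group_bijection L G \<pi> X m\<^sub>X h\<^sub>0 f
    using assms
    by (simp add: module_over_group_bijection_def module_over_group_bijection_axioms_def)
  show ?thesis by (rule reflection_map_k)
qed

end
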